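(* The dynamic programming algorithm described in the context correctly returns a global optimal solution $\mathbf y^*=(y_1^*,\dots,y_N^* )$ of the problem $$\min_{\mathbf y\in\mathbb R^N}\ \sum_{i=1}^N\Big(-c_iU(y_i)+\frac\sigma2(y_i-w_i)^2\Big)\quad\text{s.t.}\quad y_1\le y_2\le\dots\le y_N .$$
   Context: Utility. Fix $B\in\mathbb R$ and a function $U:\mathbb R\to\mathbb R$ such that: (1) $U$ is strictly increasing and continuous on $\mathbb R$; (2) $U$ is three times continuously differentiable on $(-\infty,B)$ and on $(B,\infty)$; (3) $U''>0$ on $(-\infty,B)$ and $U''<0$ on $(B,\infty)$; (4) $U'''>0$ on $(-\infty,B)$; (5) $U'(B^-)=\infty$ if and only if $U'(B^+)=\infty$, where $U'(B^\pm)=\lim_{y\to B^\pm}U'(y)$. Data. $\sigma>0$, $w_1\le w_2\le\dots\le w_N$ are real, and $a_i>0$, $b_i>0$ for $i=1,\dots,N$. The weight $c_i$ in $c_iU(y_i)$ equals $a_i$ if $y_i\le B$ and $b_i$ if $y_i>B$. Put $f_i(y)=-c_iU(y)+\frac\sigma2(y-w_i)^2$, i.e. $f_i(y)=-a_iU(y)+\frac\sigma2(y-w_i)^2$ for $y\le B$ and $f_i(y)=-b_iU(y)+\frac\sigma2(y-w_i)^2$ for $y>B$. Put $l_b=w_1$ and $u_b=\max_{i=1,\dots,N}\max\big(B+1,\ w_i+\frac{b_iU'(B+1)}{\sigma}\big)$. Roots of univariate monotone continuous functions on an interval are assumed to be computable exactly. A function of the form $\zeta$ means $\zeta_{a,b,w,s,U}(y)=-aU(y)+\frac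 s2(y-w)^2$ for $y\le B$ and $-bU(y)+\frac s2(y-w)^2$ for $y>B$. Procedures. - Decompose$([p,q],\phi)$: for $\phi$ equal on $[p,q]$ to a function of the form $\zeta$ with $a,b,s>0$ plus a constant, it cuts $[p,q]$ at the local minimizers and local maximizers of $\phi$ in it and returns the resulting consecutive intervals, on each of which $\phi$ is strictly increasing or strictly decreasing. - Update$([p,q],\delta,\kappa)$: for $\delta$ continuous and strictly monotone on $[p,q]$ and a constant $\kappa\le\delta(p)$, it returns the explicit expression of $\theta(z)=\min\{\kappa,\min_{p\le y\le z}\delta(y)\}$ on $[p,q]$ together with its supporting intervals: if $\delta$ is strictly increasing, or $\delta$ is strictly decreasing with $\delta(q)\ge\kappa$, then $\theta\equiv\kappa$ on the single interval $[p,q]$; if $\delta$ is strictly decreasing and $\delta(p)=\kappa$, then $\theta=\delta$ on the single interval $[p,q]$; if $\delta$ is strictly decreasing and $\delta(p)>\kappa>\delta(q)$, then with $r\in(p,q)$ the unique point with $\delta(r)=\kappa$, $\theta=\kappa$ on $[p,r]$ and $\theta=\delta$ on $[r,q]$, and the intervals are $[p,r],[r,q]$. - Merge: given consecutive intervals supporting $h_n$, it merges all consecutive intervals on which $h_n$ is constant. Algorithm. Start with $h_1\equiv0$ and the list of intervals $L^1=\{[l_b,u_b]\}$. Forward: for $n=2,\dots,N+1$, let $\phi_{n-1}=f_{n-1}+h_{n-1}$, set $h_n(l_b)=\phi_{n-1}(l_b)$ and $L^n=\emptyset$. Go through the intervals of $L^{n-1}$ from left to right; apply Decompose to each of them with $\phi_{n-1}$;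 for each resulting interval $[t_i,t_{i+1}]$, from left to right, define $h_n$ on $[t_i,t_{i+1}]$ and a list of intervals $Q_i$ as the output of Update$([t_i,t_{i+1}],\phi_{n-1},h_n(t_i))$, and replace $L^n$ by Merge$(L^n\cup Q_i)$. Backward: set $y_{N+1}^*=u_b$; for $n=N+1,N,\dots,2$, find an interval $[s_k^n,s_{k+1}^n]\in L^n$ containing $y_n^*$; if $h_n$ is constant on it set $y_{n-1}^*=s_k^n$, otherwise set $y_{n-1}^*=y_n^*$. Return $(y_1^*,\dots,y_N^* )$.
   Formalization: The formal theorem additionally assumes that every f_i is continuous, i.e. a_i U(B) = b_i U(B) (for instance U(B) = 0); without this the minimum may fail to be attained and Update, defined only for continuous functions, may not apply. *)

theory Defs
  imports "HOL-Analysis.Analysis"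
begin

definition C3_on :: "(real \<Rightarrow> real) \<Rightarrow> real set \<Rightarrow> bool" where
  "C3_on f S \<longleftrightarrow>
     (\<forall>k<3. (deriv ^^ k) f differentiable_on S) \<and> continuous_on S ((deriv ^^ 3) f)"

definition s_shaped_utility :: "(real \<Rightarrow> real) \<Rightarrow> real \<Rightarrow> bool" where
  "s_shaped_utility U B \<longleftrightarrow>
     strict_mono U \<and> continuous_on UNIV U \<and>
     C3_on U {..<B} \<and> C3_on U {B<..} \<and>
     (\<forall>y<B. (deriv ^^ 2) U y > 0) \<and> (\<forall>y>B. (deriv ^^ 2) U y < 0) \<and>
     (\<forall>y<B. (deriv ^^ 3) U y > 0) \<and>
     (filterlim (deriv U) at_top (at_left B) \<longleftrightarrow> filterlim (deriv U) at_top (at_right B))"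

definition zeta :: "(real \<Rightarrow> real) \<Rightarrow> real \<Rightarrow> real \<Rightarrow> real \<Rightarrow> real \<Rightarrow> real \<Rightarrow> real \<Rightarrow> real" where
  "zeta U B a b w s y = - (if y \<le> B then a else b) * U y + s / 2 * (y - w)\<^sup>2"

(* The procedures are input/output relations.  Their preconditions are part of the relations, so
   a call outside its contract has no output. *)

definition cut_points :: "real \<Rightarrow> real \<Rightarrow> (real \<Rightarrow> real) \<Rightarrow> real set" where
  "cut_points p q \<phi> = {p, q} \<union>
     {x \<in> {p..q}. (\<forall>\<^sub>F y in at x within {p..q}. \<phi> x \<le> \<phi> y) \<or>
                  (\<forall>\<^sub>F y in at x within {p..q}. \<phi> y \<le> \<phi> x)}"

definition decompose ::
  "(real \<Rightarrow> real) \<Rightarrow> real \<Rightarrow> (real \<Rightarrow> real) \<Rightarrow> real \<times> real \<Rightarrow> (real \<times> real) list \<Rightarrow> bool" where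
  "decompose U B \<phi> = (\<lambda>(p, q) Q.
     (\<exists>a b w s c. a > 0 \<and> b > 0 \<and> s > 0 \<and> (\<forall>y\<in>{p..q}. \<phi> y = zeta U B a b w s y + c)) \<and>
     finite (cut_points p q \<phi>) \<and>
     (let ts = sorted_list_of_set (cut_points p q \<phi>) in Q = zip ts (tl ts)))"

(* update p q \<delta> \<kappa> \<theta> Q: only the values of \<theta> on [p, q] are meaningful. *)
inductive update ::
  "real \<Rightarrow> real \<Rightarrow> (real \<Rightarrow> real) \<Rightarrow> real \<Rightarrow> (real \<Rightarrow> real) \<Rightarrow> (real \<times> real) list \<Rightarrow> bool"
  for p q \<delta> \<kappa> where
  increasing: "continuous_on {p..q} \<delta> \<Longrightarrow> \<kappa> \<le> \<delta> p \<Longrightarrow> strict_mono_on {p..q} \<delta> \<Longrightarrow>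
     update p q \<delta> \<kappa> (\<lambda>_. \<kappa>) [(p, q)]"
| decreasing_above: "continuous_on {p..q} \<delta> \<Longrightarrow> \<kappa> \<le> \<delta> p \<Longrightarrow> strict_antimono_on {p..q} \<delta> \<Longrightarrow>
     \<delta> q \<ge> \<kappa> \<Longrightarrow> update p q \<delta> \<kappa> (\<lambda>_. \<kappa>) [(p, q)]"
| decreasing_below: "continuous_on {p..q} \<delta> \<Longrightarrow> strict_antimono_on {p..q} \<delta> \<Longrightarrow>
     \<delta> p = \<kappa> \<Longrightarrow> update p q \<delta> \<kappa> \<delta> [(p, q)]"
| decreasing_crossing: "continuous_on {p..q} \<delta> \<Longrightarrow> strict_antimono_on {p..q} \<delta> \<Longrightarrow>
     \<delta> p > \<kappa> \<Longrightarrow> \<kappa> > \<delta> q \<Longrightarrow> p < r \<Longrightarrow> r < q \<Longrightarrow> \<delta> r = \<kappa> \<Longrightarrow>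
     update p q \<delta> \<kappa> (\<lambda>y. if y \<le> r then \<kappa> else \<delta> y) [(p, r), (r, q)]"

fun merge :: "(real \<Rightarrow> real) \<Rightarrow> (real \<times> real) list \<Rightarrow> (real \<times> real) list" where
  "merge h ((p, q) # (q', r) # L) =
     (if h constant_on {p..q} \<and> h constant_on {q'..r} then merge h ((p, r) # L)
      else (p, q) # merge h ((q', r) # L))"
| "merge h L = L"

(* sweep \<phi> T (h, L) (h', L'): starting from the partially built function h and interval list L,
   processing the intervals T from left to right yields h' and L'. *)
inductive sweep ::
  "(real \<Rightarrow> real) \<Rightarrow> (real \<times> real) list \<Rightarrow>
   (real \<Rightarrow> real) \<times> (real \<times> real) list \<Rightarrow> (real \<Rightarrow> real) \<times> (real \<times> real) list \<Rightarrow> bool"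
  for \<phi> where
  "sweep \<phi> [] hL hL"
| "update p q \<phi> (h p) \<theta> Q \<Longrightarrow> h' = (\<lambda>y. if y \<in> {p..q} then \<theta> y else h y) \<Longrightarrow>
   sweep \<phi> T (h', merge h' (L @ Q)) hL \<Longrightarrow> sweep \<phi> ((p, q) # T) (h, L) hL"

(* The function h is meaningful only on [l, u], where l and u are the ends of the interval list;
   elsewhere it keeps the dummy value 0. *)
definition forward_step ::
  "(real \<Rightarrow> real) \<Rightarrow> real \<Rightarrow> real \<Rightarrow> (real \<Rightarrow> real) \<Rightarrow> (real \<times> real) list \<Rightarrow>
   (real \<Rightarrow> real) \<Rightarrow> (real \<times> real) list \<Rightarrow> bool" where
  "forward_step U B l \<phi> L h' L' \<longleftrightarrow>
     (\<exists>Ts. list_all2 (decompose U B \<phi>) L Ts \<and>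
           sweep \<phi> (concat Ts) ((\<lambda>_. 0)(l := \<phi> l), []) (h', L'))"

definition forward_pass ::
  "(real \<Rightarrow> real) \<Rightarrow> real \<Rightarrow> nat \<Rightarrow> (nat \<Rightarrow> real \<Rightarrow> real) \<Rightarrow> real \<Rightarrow> real \<Rightarrow>
   (nat \<Rightarrow> real \<Rightarrow> real) \<Rightarrow> (nat \<Rightarrow> (real \<times> real) list) \<Rightarrow> bool" where
  "forward_pass U B N f l u h L \<longleftrightarrow>
     h 1 = (\<lambda>_. 0) \<and> L 1 = [(l, u)] \<and>
     (\<forall>n\<in>{2..N + 1}.
        forward_step U B l (\<lambda>y. f (n - 1) y + h (n - 1) y) (L (n - 1)) (h n) (L n))"

(* When y n is a common endpoint of two intervals, either of them may be chosen. *)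
definition backward_pass ::
  "nat \<Rightarrow> real \<Rightarrow> (nat \<Rightarrow> real \<Rightarrow> real) \<Rightarrow> (nat \<Rightarrow> (real \<times> real) list) \<Rightarrow> (nat \<Rightarrow> real) \<Rightarrow> bool" where
  "backward_pass N u h L y \<longleftrightarrow>
     y (N + 1) = u \<and>
     (\<forall>n\<in>{2..N + 1}. \<exists>(p, q)\<in>set (L n). y n \<in> {p..q} \<and>
        y (n - 1) = (if h n constant_on {p..q} then p else y n))"

definition upper_bound ::
  "(real \<Rightarrow> real) \<Rightarrow> real \<Rightarrow> nat \<Rightarrow> real \<Rightarrow> (nat \<Rightarrow> real) \<Rightarrow> (nat \<Rightarrow> real) \<Rightarrow> real" where
  "upper_bound U B N \<sigma> w b =
     Max ((\<lambda>i. max (B + 1) (w i + b i * deriv U (B + 1) / \<sigma>)) ` {1..N})"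

(* Some run of the algorithm returns y 1, ..., y N; the other values of y are irrelevant. *)
definition dp_returns ::
  "(real \<Rightarrow> real) \<Rightarrow> real \<Rightarrow> nat \<Rightarrow> real \<Rightarrow> (nat \<Rightarrow> real) \<Rightarrow> (nat \<Rightarrow> real) \<Rightarrow> (nat \<Rightarrow> real) \<Rightarrow>
   (nat \<Rightarrow> real) \<Rightarrow> bool" where
  "dp_returns U B N \<sigma> w a b y \<longleftrightarrow>
     (let f = (\<lambda>i. zeta U B (a i) (b i) (w i) \<sigma>); u = upper_bound U B N \<sigma> w b
      in \<exists>h L. forward_pass U B N f (w 1) u h L \<and> backward_pass N u h L y)"

end

theory Submission
  imports Defs
begin

text \<open>
The problem is solved by dynamic programming over the value of the last variable.  Its correctness
rests on three observations.

First, the stages can be computed.  On each interval of the current list, the function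
$\<phi>_n = f_n + h_n$ is of the form \<^const>\<open>zeta\<close> up to a constant: the previous value function $h_n$ is
there either constant or a copy of $\<phi>_{n-1}$, and functions of this form are closed under addition
(\<open>zeta_form_zeta_plus\<close>).  Such a function has finitely many local extrema, because
repeated use of Rolle's theorem reduces the question to a derivative without zeros on either side of
\<open>B\<close> (\<open>finite_cut_points\<close>), and it is strictly monotone between them.  So every step of the
forward pass can be carried out.

Second, each stage is a Bellman step.  The sweep maintains $h_{n+1}(z) \<le> \<phi>_n(y)$ for all $y \<le> z$
(\<open>sweep_inv_step\<close>).  Conversely $h_{n+1}$ is attained by $\<phi>_n$: where $h_{n+1}$ is not constant, it equals
$\<phi>_n$, and on a constant interval its value is $\<phi>_n$ at the left end.  The latter depends on the merging,
which makes sure that the interval before a constant one is a copy of $\<phi>_n$ (\<open>merge_value_at_start\<close>).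
The backward pass picks exactly these points.  Summing over the stages, the point that it returns
costs $h_{N+1}(u)$ (\<open>backward_pass_value\<close>), and no monotone point in the box $[l, u]^N$ costs less
(\<open>bellman_lower_bound\<close>).

Third, the box loses nothing.  Every $f_i$ is decreasing left of $w_1$, also across $B$ because it is
continuous there, and increasing right of $u$, so
clamping a feasible point to the box keeps it feasible without raising its cost (\<open>f_clamp_le\<close>).
\<close>

section \<open>Critical points of zeta\<close>

lemma s_shaped_deriv:
  assumes "s_shaped_utility U B" "x \<noteq> B" "k < 3"
  shows "((deriv ^^ k) U has_real_derivative (deriv ^^ Suc k) U x) (at x)"
proof -
  have "\<exists>S. open S \<and> x \<in> S \<and> C3_on U S"
    using assms unfolding s_shaped_utility_def
    by (cases "x < B") (auto intro: exI[of _ "{..<B}"] exI[of _ "{B<..}"])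
  then obtain S where S: "open S" "x \<in> S" "C3_on U S" by blast
  then have "(deriv ^^ k) U differentiable_on S" using assms(3) by (auto simp: C3_on_def)
  then have "(deriv ^^ k) U field_differentiable at x"
    using S by (simp add: differentiable_on_eq_differentiable_at field_differentiable_def
        real_differentiable_def)
  then show ?thesis using DERIV_deriv_iff_field_differentiable by auto
qed

lemma zeta_deriv:
  assumes U: "s_shaped_utility U B" and "x \<noteq> B"
  shows "(zeta U B a b w s has_real_derivative
    - (if x \<le> B then a else b) * deriv U x + s * (x - w)) (at x)"
proof -
  define c where "c = (if x \<le> B then a else b)"
  define S where "S = (if x \<le> B then {..<B} else {B<..})"
  have dU: "(U has_real_derivative deriv U x) (at x)" using s_shaped_deriv[OF assms, of 0] by simp
  have "((\<lambda>y. - c * U y + s / 2 * (y - w)\<^sup>2) has_real_derivative - c * deriv U x + s * (x - w)) (at x)"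
    by (rule derivative_eq_intros dU refl | simp)+
  moreover have "open S" "x \<in> S" using assms(2) by (auto simp: S_def)
  moreover have "\<And>y. y \<in> S \<Longrightarrow> - c * U y + s / 2 * (y - w)\<^sup>2 = zeta U B a b w s y"
    by (auto simp: S_def c_def zeta_def split: if_splits)
  ultimately show ?thesis
    unfolding c_def[symmetric] using has_field_derivative_transform_within_open by blast
qed

text \<open>By Rolle's theorem, two zeros $x < y$ of \<^term>\<open>f\<close> are separated by a zero of the derivative, so a zero
\<^term>\<open>z\<close> of \<^term>\<open>f\<close> is determined by the set of zeros of the derivative that lie below \<^term>\<open>z\<close>.
Finitely many zeros of the derivative leave only finitely many such sets.\<close>

lemma finite_zeros_of_finite_zeros_deriv:
  fixes f f' :: "real \<Rightarrow> real"
  assumes f: "\<And>x. x \<in> S \<Longrightarrow> (f has_real_derivative f' x) (at x)"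
    and S: "is_interval S" and fin: "finite {x \<in> S. f' x = 0}"
  shows "finite {x \<in> S. f x = 0}"
proof -
  let ?Z = "{x \<in> S. f x = 0}" and ?Z' = "{x \<in> S. f' x = 0}"
  have sep: "\<exists>\<xi>. \<xi> \<in> ?Z' \<inter> {..<y} \<and> \<xi> \<notin> ?Z' \<inter> {..<x}" if "x \<in> ?Z" "y \<in> ?Z" "x < y" for x y
  proof -
    have sub: "{x..y} \<subseteq> S" using that S by (auto simp: is_interval_1)
    have "\<exists>z>x. z < y \<and> DERIV f z :> 0"
    proof (rule Rolle)
      show "continuous_on {x..y} f" using sub f by (meson DERIV_continuous_on has_field_derivative_at_within subsetD)
      show "f differentiable at z" if "x < z" "z < y" for z
        using f sub that by (meson atLeastAtMost_iff less_imp_le real_differentiable_def subsetD)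
    qed (use that in auto)
    then obtain z where z: "x < z" "z < y" "DERIV f z :> 0" by blast
    then have "f' z = 0" using f sub DERIV_unique by (meson atLeastAtMost_iff less_imp_le subsetD)
    then show ?thesis using z sub by (intro exI[of _ z]) auto
  qed
  have "inj_on (\<lambda>z. ?Z' \<inter> {..<z}) ?Z"
  proof (rule inj_onI, rule ccontr)
    fix x y assume "x \<in> ?Z" "y \<in> ?Z" "?Z' \<inter> {..<x} = ?Z' \<inter> {..<y}" "x \<noteq> y"
    then show False using sep[of x y] sep[of y x] by (metis (no_types, lifting) linorder_less_linear)
  qed
  moreover have "finite ((\<lambda>z. ?Z' \<inter> {..<z}) ` ?Z)"
    by (rule finite_subset[of _ "Pow ?Z'"]) (use fin in auto)
  ultimately show ?thesis using finite_imageD by blast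
qed

text \<open>Below \<^term>\<open>B\<close> the third derivative of \<^const>\<open>zeta\<close>, $-a U^{(3)}$, is negative; above \<^term>\<open>B\<close>
the second one, $-b U'' + s$, is positive.  Applying Rolle's theorem twice on the left and once on the
right leaves finitely many zeros of the first derivative.\<close>

lemma finite_critical_points_zeta:
  assumes U: "s_shaped_utility U B" and pos: "a > 0" "b > 0" "s > 0"
  shows "finite {x \<in> - {B}. - (if x \<le> B then a else b) * deriv U x + s * (x - w) = 0}"
proof -
  note U' = s_shaped_deriv[OF U, of _ 1, simplified] s_shaped_deriv[OF U, of _ 2, simplified]
  have d1: "((\<lambda>x. - c * deriv U x + s * (x - w)) has_real_derivative - c * (deriv ^^ 2) U x + s) (at x)"
    if "x \<noteq> B" for x c
    using that by (auto intro!: derivative_eq_intros U' simp: numeral_2_eq_2)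
  have d2: "((\<lambda>x. - c * (deriv ^^ 2) U x + s) has_real_derivative - c * (deriv ^^ 3) U x) (at x)"
    if "x \<noteq> B" for x c
    using that s_shaped_deriv[OF U that, of 2] by (auto intro!: derivative_eq_intros simp: numeral_3_eq_3)
  have "{x \<in> {..<B}. - a * (deriv ^^ 3) U x = 0} = {}"
    using U pos by (auto simp: s_shaped_utility_def)
  then have "finite {x \<in> {..<B}. - a * (deriv ^^ 3) U x = 0}" by (simp only: finite.emptyI)
  then have "finite {x \<in> {..<B}. - a * (deriv ^^ 2) U x + s = 0}"
    by (intro finite_zeros_of_finite_zeros_deriv[OF d2]) (auto simp: is_interval_1)
  then have L: "finite {x \<in> {..<B}. - a * deriv U x + s * (x - w) = 0}"
    by (intro finite_zeros_of_finite_zeros_deriv[OF d1]) (auto simp: is_interval_1)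
  have "- b * (deriv ^^ 2) U x + s > 0" if "x > B" for x
  proof -
    have "(deriv ^^ 2) U x < 0" using U that by (auto simp: s_shaped_utility_def)
    then have "b * (deriv ^^ 2) U x < 0" using pos by (simp add: mult_pos_neg)
    then show ?thesis using pos by simp
  qed
  then have "{x \<in> {B<..}. - b * (deriv ^^ 2) U x + s = 0} = {}" by force
  then have "finite {x \<in> {B<..}. - b * (deriv ^^ 2) U x + s = 0}" by (simp only: finite.emptyI)
  then have R: "finite {x \<in> {B<..}. - b * deriv U x + s * (x - w) = 0}"
    by (intro finite_zeros_of_finite_zeros_deriv[OF d1]) (auto simp: is_interval_1)
  show ?thesis
    by (rule finite_subset[OF _ finite_UnI[OF L R]]) (auto split: if_splits)
qed

text \<open>The functions that can be decomposed.  The parameters may differ from one interval to the next: they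
depend on which of the functions $f_i$ have been added up there.\<close>

definition zeta_form :: "(real \<Rightarrow> real) \<Rightarrow> real \<Rightarrow> (real \<Rightarrow> real) \<Rightarrow> real \<Rightarrow> real \<Rightarrow> bool" where
  "zeta_form U B \<phi> p q \<longleftrightarrow>
     (\<exists>a b w s c. a > 0 \<and> b > 0 \<and> s > 0 \<and> (\<forall>y\<in>{p..q}. \<phi> y = zeta U B a b w s y + c))"

lemma zeta_form_subinterval:
  "zeta_form U B \<phi> p q \<Longrightarrow> {s..t} \<subseteq> {p..q} \<Longrightarrow> zeta_form U B \<phi> s t"
  unfolding zeta_form_def by (meson subsetD)

lemma zeta_form_cong:
  "(\<And>y. y \<in> {p..q} \<Longrightarrow> \<psi> y = \<phi> y) \<Longrightarrow> zeta_form U B \<psi> p q = zeta_form U B \<phi> p q"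
  unfolding zeta_form_def by simp

text \<open>Completing the square: the sum of two weighted squares is one weighted square around the weighted mean,
plus a constant.\<close>

lemma zeta_add:
  assumes "s + s' \<noteq> 0"
  shows "zeta U B a b w s y + zeta U B a' b' w' s' y =
    zeta U B (a + a') (b + b') ((s * w + s' * w') / (s + s')) (s + s') y
    + (s * w\<^sup>2 + s' * w'\<^sup>2 - (s * w + s' * w')\<^sup>2 / (s + s')) / 2"
proof -
  define v where "v = (s * w + s' * w') / (s + s')"
  have v: "s * w + s' * w' = (s + s') * v" using assms by (simp add: v_def)
  have 1: "(s * w + s' * w')\<^sup>2 / (s + s') = (s + s') * v\<^sup>2"
    unfolding v using assms by (simp add: power2_eq_square)
  have 2: "s * (w * y) + s' * (w' * y) = s * (v * y) + s' * (v * y)"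
    using arg_cong[OF v, of "\<lambda>t. t * y"] by (simp add: algebra_simps)
  have "s / 2 * (y - w)\<^sup>2 + s' / 2 * (y - w')\<^sup>2 =
    (s + s') / 2 * (y - v)\<^sup>2 + (s * w\<^sup>2 + s' * w'\<^sup>2 - (s + s') * v\<^sup>2) / 2"
    using 2 by (simp add: power2_eq_square field_simps)
  then show ?thesis unfolding 1 v_def[symmetric] zeta_def
    by (cases "y \<le> B") (simp_all add: distrib_right left_diff_distrib)
qed

text \<open>The reason why one stage can follow another: adding the next $f_i$ to a value function that is constant
or already of the right form on an interval leads back to that form.\<close>

lemma zeta_form_zeta_plus:
  assumes "a > 0" "b > 0" "s > 0" "h constant_on {p..q} \<or> zeta_form U B h p q"
  shows "zeta_form U B (\<lambda>y. zeta U B a b w s y + h y) p q"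
  using assms(4)
proof
  assume "h constant_on {p..q}"
  then show ?thesis using assms unfolding zeta_form_def constant_on_def by fastforce
next
  assume "zeta_form U B h p q"
  then obtain a' b' w' s' c where h: "a' > 0" "b' > 0" "s' > 0"
    "\<And>y. y \<in> {p..q} \<Longrightarrow> h y = zeta U B a' b' w' s' y + c"
    unfolding zeta_form_def by blast
  then have "\<And>y. y \<in> {p..q} \<Longrightarrow> zeta U B a b w s y + h y =
    zeta U B (a + a') (b + b') ((s * w + s' * w') / (s + s')) (s + s') y
    + ((s * w\<^sup>2 + s' * w'\<^sup>2 - (s * w + s' * w')\<^sup>2 / (s + s')) / 2 + c)"
    using zeta_add[of s s' U B a b w _ a' b' w'] assms by (simp add: add.assoc[symmetric])
  moreover have "a + a' > 0" "b + b' > 0" "s + s' > 0" using assms h by auto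
  ultimately show ?thesis unfolding zeta_form_def by blast
qed

text \<open>A local extremum inside the interval is a critical point, unless it sits at the kink \<^term>\<open>B\<close>.\<close>

lemma finite_cut_points:
  assumes U: "s_shaped_utility U B" and \<phi>: "zeta_form U B \<phi> p q"
  shows "finite (cut_points p q \<phi>)"
proof -
  obtain a b w s c where z: "a > 0" "b > 0" "s > 0"
    "\<And>y. y \<in> {p..q} \<Longrightarrow> \<phi> y = zeta U B a b w s y + c"
    using \<phi> unfolding zeta_form_def by blast
  let ?g = "\<lambda>x. - (if x \<le> B then a else b) * deriv U x + s * (x - w)"
  have "?g x = 0" if x: "x \<in> cut_points p q \<phi>" "x \<notin> {p, q, B}" for x
  proof -
    have pq: "p < x" "x < q" using x by (auto simp: cut_points_def)
    have at: "at x within {p..q} = at x" using pq by (simp add: at_within_Icc_at)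
    have ev: "\<forall>\<^sub>F y in at x. y \<in> {p..q}"
      using pq eventually_at_in_open'[of "{p<..<q}" x] by (auto elim: eventually_mono)
    have D: "(zeta U B a b w s has_real_derivative ?g x) (at x)" using zeta_deriv[OF U] x by blast
    consider "\<forall>\<^sub>F y in at x. zeta U B a b w s x \<le> zeta U B a b w s y"
      | "\<forall>\<^sub>F y in at x. zeta U B a b w s y \<le> zeta U B a b w s x"
    proof -
      have "(\<forall>\<^sub>F y in at x. \<phi> x \<le> \<phi> y) \<or> (\<forall>\<^sub>F y in at x. \<phi> y \<le> \<phi> x)"
        using x at by (auto simp: cut_points_def)
      then show thesis
      proof
        assume "\<forall>\<^sub>F y in at x. \<phi> x \<le> \<phi> y"
        then have "\<forall>\<^sub>F y in at x. zeta U B a b w s x \<le> zeta U B a b w s y"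
          using ev by eventually_elim (use z(4) pq in auto)
        then show thesis using that by blast
      next
        assume "\<forall>\<^sub>F y in at x. \<phi> y \<le> \<phi> x"
        then have "\<forall>\<^sub>F y in at x. zeta U B a b w s y \<le> zeta U B a b w s x"
          using ev by eventually_elim (use z(4) pq in auto)
        then show thesis using that by blast
      qed
    qed
    then show ?thesis
    proof cases
      case 1
      then obtain d where "d > 0" "\<And>y. y \<noteq> x \<Longrightarrow> dist y x < d \<Longrightarrow> zeta U B a b w s x \<le> zeta U B a b w s y"
        unfolding eventually_at by blast
      then show ?thesis
        by (intro DERIV_local_min[OF D, of d]) (auto simp: dist_real_def abs_minus_commute, metis order_refl)
    next
      case 2
      then obtain d where "d > 0" "\<And>y. y \<noteq> x \<Longrightarrow> dist y x < d \<Longrightarrow> zeta U B a b w s y \<le> zeta U B a b w s x"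
        unfolding eventually_at by blast
      then show ?thesis
        by (intro DERIV_local_max[OF D, of d]) (auto simp: dist_real_def abs_minus_commute, metis order_refl)
    qed
  qed
  then have "cut_points p q \<phi> \<subseteq> {p, q, B} \<union> {x \<in> - {B}. ?g x = 0}" by blast
  then show ?thesis
    by (rule finite_subset) (use finite_critical_points_zeta[OF U z(1-3)] in auto)
qed

text \<open>If a continuous function takes the same value at two points, then it has a local extremum strictly
between them.  Hence it is injective, and so strictly monotone, where it has no interior extremum.\<close>

lemma strict_monotone_between_cut_points:
  assumes cont: "continuous_on {p..q} \<phi>" and st: "{s..t} \<subseteq> {p..q}"
    and no: "cut_points p q \<phi> \<inter> {s<..<t} = {}"
  shows "strict_mono_on {s..t} \<phi> \<or> strict_antimono_on {s..t} \<phi>"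
proof -
  have extremum: "m \<in> cut_points p q \<phi>"
    if "x < m" "m < y" "{x..y} \<subseteq> {s..t}"
      "(\<forall>v\<in>{x..y}. \<phi> m \<le> \<phi> v) \<or> (\<forall>v\<in>{x..y}. \<phi> v \<le> \<phi> m)" for x m y
  proof -
    have ev: "\<forall>\<^sub>F v in at m within {p..q}. v \<in> {x..y}"
      unfolding eventually_at_topological using that by (intro exI[of _ "{x<..<y}"]) auto
    have "(\<forall>\<^sub>F v in at m within {p..q}. \<phi> m \<le> \<phi> v) \<or> (\<forall>\<^sub>F v in at m within {p..q}. \<phi> v \<le> \<phi> m)"
      using that(4)
    proof
      assume m: "\<forall>v\<in>{x..y}. \<phi> m \<le> \<phi> v"
      have "\<forall>\<^sub>F v in at m within {p..q}. \<phi> m \<le> \<phi> v"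
        by (rule eventually_mono[OF ev]) (use m in blast)
      then show ?thesis ..
    next
      assume m: "\<forall>v\<in>{x..y}. \<phi> v \<le> \<phi> m"
      have "\<forall>\<^sub>F v in at m within {p..q}. \<phi> v \<le> \<phi> m"
        by (rule eventually_mono[OF ev]) (use m in blast)
      then show ?thesis ..
    qed
    moreover have "m \<in> {p..q}" using that(1-3) st by auto
    ultimately show ?thesis unfolding cut_points_def by blast
  qed
  have "\<phi> x \<noteq> \<phi> y" if xy: "x \<in> {s..t}" "y \<in> {s..t}" "x < y" for x y
  proof
    assume eq: "\<phi> x = \<phi> y"
    have sub: "{x..y} \<subseteq> {s..t}" and ne: "{x..y} \<noteq> {}" using xy by auto
    from sub have c: "continuous_on {x..y} \<phi>" by (rule continuous_on_subset[OF cont order_trans[OF _ st]])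
    obtain m where m: "m \<in> {x..y}" "\<forall>v\<in>{x..y}. \<phi> m \<le> \<phi> v"
      using continuous_attains_inf[OF compact_Icc ne c] by blast
    obtain M where M: "M \<in> {x..y}" "\<forall>v\<in>{x..y}. \<phi> v \<le> \<phi> M"
      using continuous_attains_sup[OF compact_Icc ne c] by blast
    have "\<exists>v. x < v \<and> v < y \<and> v \<in> cut_points p q \<phi>"
    proof (cases "m \<in> {x<..<y} \<or> M \<in> {x<..<y}")
      case True
      then show ?thesis
      proof
        assume i: "m \<in> {x<..<y}"
        then have "m \<in> cut_points p q \<phi>" using extremum[OF _ _ sub, of m] m by simp
        then show ?thesis using i by auto
      next
        assume i: "M \<in> {x<..<y}"
        then have "M \<in> cut_points p q \<phi>" using extremum[OF _ _ sub, of M] M by simp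
        then show ?thesis using i by auto
      qed
    next
      case False
      then have "m = x \<or> m = y" "M = x \<or> M = y" using m(1) M(1) by auto
      then have "\<phi> m = \<phi> x" "\<phi> M = \<phi> x" using eq by auto
      then have const: "\<forall>v\<in>{x..y}. \<phi> v = \<phi> x" using m M by (metis order_antisym)
      have "(x + y) / 2 \<in> {x..y}" using xy by (auto simp: field_simps)
      then have "\<forall>v\<in>{x..y}. \<phi> ((x + y) / 2) \<le> \<phi> v" using const by (metis order_refl)
      moreover have "x < (x + y) / 2" "(x + y) / 2 < y" using xy by auto
      ultimately show ?thesis using extremum[of x "(x + y) / 2" y] sub by blast
    qed
    then obtain v where "x < v" "v < y" "v \<in> cut_points p q \<phi>" by blast
    moreover from this have "v \<in> {s<..<t}" using xy by simp
    ultimately show False using no by blast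
  qed
  then have "inj_on \<phi> {s..t}" by (intro linorder_inj_onI) auto
  moreover have "continuous_on {s..t} \<phi>" using cont st by (rule continuous_on_subset)
  ultimately show ?thesis by (simp only: injective_eq_monotone_map[OF is_interval_cc])
qed

section \<open>Interval lists\<close>

text \<open>The intervals have to be nondegenerate, since decomposing a single point yields no interval at all.\<close>

fun chain :: "real \<Rightarrow> (real \<times> real) list \<Rightarrow> real \<Rightarrow> bool" where
  "chain l [] u \<longleftrightarrow> l = u"
| "chain l ((p, q) # L) u \<longleftrightarrow> p = l \<and> p < q \<and> chain q L u"

lemma chain_le: "chain l L u \<Longrightarrow> l \<le> u"
  by (induction l L u rule: chain.induct) auto

lemma chain_append: "chain l (L @ M) u \<longleftrightarrow> (\<exists>m. chain l L m \<and> chain m M u)"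
proof (induction L arbitrary: l)
  case (Cons I L)
  then show ?case by (cases I) simp
qed simp

lemma chain_subset: "chain l L u \<Longrightarrow> (p, q) \<in> set L \<Longrightarrow> l \<le> p \<and> p < q \<and> q \<le> u"
proof (induction l L u rule: chain.induct)
  case (2 l p' q' L u)
  then have c: "p' = l" "p' < q'" "chain q' L u" by simp_all
  then have "q' \<le> u" by (simp add: chain_le)
  show ?case
  proof (cases "(p, q) = (p', q')")
    case True
    then show ?thesis using c \<open>q' \<le> u\<close> by simp
  next
    case False
    then have "q' \<le> p \<and> p < q \<and> q \<le> u" using 2 c by auto
    then show ?thesis using c by simp
  qed
qed simp

lemma chain_covers: "chain l L u \<Longrightarrow> l < u \<Longrightarrow> y \<in> {l..u} \<Longrightarrow> \<exists>(p, q)\<in>set L. y \<in> {p..q}"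
proof (induction l L u rule: chain.induct)
  case (2 l p q L u)
  then have c: "p = l" "p < q" "chain q L u" by simp_all
  show ?case
  proof (cases "y \<le> q")
    case True
    then show ?thesis using 2 c by simp
  next
    case False
    then have "\<exists>(p, q)\<in>set L. y \<in> {p..q}" using 2 c by simp
    then show ?thesis by (simp add: bex_Un)
  qed
qed simp

lemma chain_concat:
  assumes "list_all2 R L Ts" and R: "\<And>p q T. R (p, q) T \<Longrightarrow> p < q \<Longrightarrow> chain p T q"
    and "chain l L u"
  shows "chain l (concat Ts) u"
  using assms(1,3)
proof (induction arbitrary: l rule: list_all2_induct)
  case (Cons I L T Ts)
  obtain p q where I: "I = (p, q)" by (cases I)
  then have "chain l T q" "chain q (concat Ts) u" using Cons R by simp_all
  then show ?case by (auto simp: chain_append)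
qed simp

lemma chain_zip_tl:
  "sorted_wrt (<) ts \<Longrightarrow> ts \<noteq> [] \<Longrightarrow> chain (hd ts) (zip ts (tl ts)) (last ts)"
proof (induction ts rule: induct_list012)
  case (3 x y zs)
  then have "chain y (zip (y # zs) zs) (last (y # zs))" by simp
  then show ?case using 3(3) by simp
qed simp_all

lemma no_element_between_zip_tl:
  fixes s t :: real
  assumes "sorted_wrt (<) ts" "(s, t) \<in> set (zip ts (tl ts))"
  shows "set ts \<inter> {s<..<t} = {}"
  using assms
proof (induction ts rule: induct_list012)
  case (3 x y zs)
  show ?case
  proof (cases "(s, t) = (x, y)")
    case True
    then show ?thesis using 3(3) by auto
  next
    case False
    then have z: "(s, t) \<in> set (zip (y # zs) zs)" using 3(4) by auto
    then have "set (y # zs) \<inter> {s<..<t} = {}" using 3(2,3) by simp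
    moreover have "s \<in> set (y # zs)" using z by (rule set_zip_leftD)
    then have "x < s" using 3(3) by auto
    ultimately show ?thesis by auto
  qed
qed simp_all

lemma decompose_chain:
  assumes "decompose U B \<phi> (p, q) Q" "p < q"
  shows "chain p Q q" and "\<And>s t. (s, t) \<in> set Q \<Longrightarrow> cut_points p q \<phi> \<inter> {s<..<t} = {}"
proof -
  let ?C = "cut_points p q \<phi>"
  define ts where "ts = sorted_list_of_set ?C"
  have fin: "finite ?C" and Q: "Q = zip ts (tl ts)"
    using assms(1) unfolding decompose_def ts_def Let_def by simp_all
  have C: "p \<in> ?C" "q \<in> ?C" "?C \<subseteq> {p..q}" using assms(2) unfolding cut_points_def by auto
  have ts: "set ts = ?C" "sorted_wrt (<) ts" using fin by (auto simp: ts_def)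
  have ne: "ts \<noteq> []" using ts C by auto
  have "hd ts = p"
  proof -
    obtain x xs where x: "ts = x # xs" using ne by (cases ts) auto
    have "x \<in> set ts" using x by simp
    then have "p \<le> x" using ts C by (metis atLeastAtMost_iff subsetD)
    moreover have "p \<in> set (x # xs)" "\<forall>v\<in>set xs. x < v" using ts C(1) unfolding x by simp_all
    then have "p = x \<or> x < p" by (metis set_ConsD)
    ultimately show ?thesis using x by simp
  qed
  moreover have "last ts = q"
  proof -
    obtain x xs where x: "ts = xs @ [x]" using ne by (cases ts rule: rev_cases) auto
    have "x \<in> set ts" using x by simp
    then have "x \<le> q" using ts C by (metis atLeastAtMost_iff subsetD)
    moreover have "q \<in> set xs \<union> {x}" "\<forall>v\<in>set xs. v < x"
      using ts C(2) unfolding x by (simp_all add: sorted_wrt_append)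
    then have "q = x \<or> q < x" by blast
    ultimately show ?thesis using x by simp
  qed
  ultimately show "chain p Q q" using chain_zip_tl[OF ts(2) ne] Q by simp
  show "?C \<inter> {s<..<t} = {}" if "(s, t) \<in> set Q" for s t
    using no_element_between_zip_tl[OF ts(2)] that Q ts by simp
qed

section \<open>One forward step\<close>

text \<open>All four cases of the update yield a lower bound both for \<^term>\<open>\<kappa>\<close> and for the earlier values of
\<^term>\<open>\<delta>\<close>.  Together with the last claim, which says that the bound is either constant or equal to
\<^term>\<open>\<delta>\<close>, this is the only way in which the running minimum enters the correctness proof.\<close>

lemma update_spec:
  assumes "update p q \<delta> \<kappa> \<theta> Q" "p < q"
  shows "\<theta> p = \<kappa>" and "chain p Q q"
    and "\<And>z. z \<in> {p..q} \<Longrightarrow> \<theta> z \<le> \<kappa>"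
    and "\<And>y z. p \<le> y \<Longrightarrow> y \<le> z \<Longrightarrow> z \<le> q \<Longrightarrow> \<theta> z \<le> \<delta> y"
    and "\<And>s t. (s, t) \<in> set Q \<Longrightarrow> \<theta> constant_on {s..t} \<or> (\<forall>y\<in>{s..t}. \<theta> y = \<delta> y)"
proof -
  have "\<theta> p = \<kappa> \<and> chain p Q q \<and> (\<forall>z\<in>{p..q}. \<theta> z \<le> \<kappa>) \<and>
    (\<forall>z\<in>{p..q}. \<forall>y\<in>{p..z}. \<theta> z \<le> \<delta> y) \<and>
    (\<forall>(s, t)\<in>set Q. \<theta> constant_on {s..t} \<or> (\<forall>y\<in>{s..t}. \<theta> y = \<delta> y))"
    using assms(1)
  proof cases
    case increasing
    have "\<kappa> \<le> \<delta> y" if "y \<in> {p..q}" for y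
      using increasing(4) that \<open>p < q\<close> strict_mono_on_leD[OF increasing(5), of p y] by simp
    then show ?thesis using increasing \<open>p < q\<close> by (auto simp: constant_on_def)
  next
    case decreasing_above
    have "\<delta> q \<le> \<delta> y" if "y \<in> {p..q}" for y
      using that \<open>p < q\<close> monotone_onD[OF decreasing_above(5), of y q] by (cases "y = q") auto
    then have "\<kappa> \<le> \<delta> y" if "y \<in> {p..q}" for y
      using decreasing_above(6) that order_trans by blast
    then show ?thesis using decreasing_above \<open>p < q\<close> by (auto simp: constant_on_def)
  next
    case decreasing_below
    have "\<delta> z \<le> \<delta> y" if "z \<in> {p..q}" "y \<in> {p..z}" for y z
      using that monotone_onD[OF decreasing_below(4), of y z] by (cases "y = z") auto
    moreover from this[of _ p] have "\<delta> z \<le> \<kappa>" if "z \<in> {p..q}" for z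
      using that decreasing_below by auto
    ultimately show ?thesis using decreasing_below \<open>p < q\<close> by auto
  next
    case (decreasing_crossing r)
    have dec: "\<delta> z \<le> \<delta> y" if "z \<in> {p..q}" "y \<in> {p..z}" for y z
      using that monotone_onD[OF decreasing_crossing(4), of y z] by (cases "y = z") auto
    have r: "p < r" "r < q" "\<delta> r = \<kappa>" using decreasing_crossing by auto
    have le: "\<kappa> \<le> \<delta> y" if "p \<le> y" "y \<le> r" for y
      using dec[of r y] that r by auto
    have ge: "\<delta> y \<le> \<kappa>" if "r \<le> y" "y \<le> q" for y
      using dec[of y r] that r by auto
    show ?thesis
      using decreasing_crossing(1,2) r dec le ge by (auto simp: constant_on_def)
  qed
  then show "\<theta> p = \<kappa>" and "chain p Q q"
    and "\<And>z. z \<in> {p..q} \<Longrightarrow> \<theta> z \<le> \<kappa>"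
    and "\<And>y z. p \<le> y \<Longrightarrow> y \<le> z \<Longrightarrow> z \<le> q \<Longrightarrow> \<theta> z \<le> \<delta> y"
    and "\<And>s t. (s, t) \<in> set Q \<Longrightarrow> \<theta> constant_on {s..t} \<or> (\<forall>y\<in>{s..t}. \<theta> y = \<delta> y)"
    by auto
qed

lemma update_exists:
  assumes cont: "continuous_on {p..q} \<delta>" and \<kappa>: "\<kappa> \<le> \<delta> p" and "p < q"
    and mono: "strict_mono_on {p..q} \<delta> \<or> strict_antimono_on {p..q} \<delta>"
  shows "\<exists>\<theta> Q. update p q \<delta> \<kappa> \<theta> Q"
  using mono
proof
  assume "strict_mono_on {p..q} \<delta>"
  then show ?thesis using update.increasing[OF cont \<kappa>] by blast
next
  assume dec: "strict_antimono_on {p..q} \<delta>"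
  consider "\<kappa> \<le> \<delta> q" | "\<delta> p = \<kappa>" | "\<delta> q < \<kappa>" "\<kappa> < \<delta> p" using \<kappa> by linarith
  then show ?thesis
  proof cases
    case 1 then show ?thesis using update.decreasing_above[OF cont \<kappa> dec] by blast
  next
    case 2 then show ?thesis using update.decreasing_below[OF cont dec] by blast
  next
    case 3
    then obtain r where r: "p \<le> r" "r \<le> q" "\<delta> r = \<kappa>"
      using IVT2'[of \<delta> q \<kappa> p] cont \<open>p < q\<close> by auto
    then have "r \<noteq> p" "r \<noteq> q" using 3 by auto
    then have "p < r" "r < q" using r by auto
    then show ?thesis using update.decreasing_crossing[OF cont dec 3(2,1) _ _ r(3)] by blast
  qed
qed

lemma constant_on_Icc_join:
  fixes h :: "real \<Rightarrow> 'a"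
  assumes "h constant_on {p..q}" "h constant_on {q..r}" "p \<le> q" "q \<le> r"
  shows "h constant_on {p..r}"
proof -
  obtain c d where c: "\<And>y. y \<in> {p..q} \<Longrightarrow> h y = c" and d: "\<And>y. y \<in> {q..r} \<Longrightarrow> h y = d"
    using assms unfolding constant_on_def by blast
  have "c = d" using c[of q] d[of q] assms by simp
  then have "h y = c" if "y \<in> {p..r}" for y using c d that by (cases "y \<le> q") auto
  then show ?thesis unfolding constant_on_def by blast
qed

lemma chain_merge: "chain l L u \<Longrightarrow> chain l (merge h L) u"
  by (induction h L arbitrary: l rule: merge.induct) auto

text \<open>Merging joins only constant intervals, so it preserves every property that constant intervals have anyway.\<close>

lemma merge_preserves:
  assumes "chain l L u" "\<And>p q. (p, q) \<in> set L \<Longrightarrow> R p q"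
    and "\<And>p q. h constant_on {p..q} \<Longrightarrow> R p q"
    and "(p, q) \<in> set (merge h L)"
  shows "R p q"
  using assms
proof (induction h L arbitrary: l rule: merge.induct)
  case (1 h p1 q1 q1' r L)
  have c: "q1' = q1" "p1 \<le> q1" "q1 \<le> r" "chain p1 ((p1, r) # L) u" "chain q1 ((q1, r) # L) u"
    using 1(3) by auto
  show ?case
  proof (cases "h constant_on {p1..q1} \<and> h constant_on {q1..r}")
    case True
    then have "R p1 r" using constant_on_Icc_join[of h p1 q1 r] c 1(5) by blast
    then have "\<And>p q. (p, q) \<in> set ((p1, r) # L) \<Longrightarrow> R p q" using 1(4) by auto
    moreover have "(p, q) \<in> set (merge h ((p1, r) # L))" using 1(6) True c by simp
    ultimately show ?thesis using 1(1)[OF _ c(4) _ 1(5)] True c(1) by blast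
  next
    case False
    then have "(p, q) = (p1, q1) \<or> (p, q) \<in> set (merge h ((q1, r) # L))" using 1(6) c(1) by auto
    moreover have "\<And>p q. (p, q) \<in> set ((q1, r) # L) \<Longrightarrow> R p q" using 1(4) c(1) by auto
    ultimately show ?thesis using 1(2)[OF _ _ _ 1(5), of q1] c(1,5) False 1(4) by auto
  qed
qed auto

text \<open>The purpose of merging.  After it, the interval to the left of a constant interval is not constant, so
\<^term>\<open>h\<close> agrees with \<^term>\<open>\<phi>\<close> on it, in particular at its right end; a constant interval without a left
neighbour starts at \<^term>\<open>l\<close>, where the two agree from the outset.  Thus the constant value on an interval
is the value of \<^term>\<open>\<phi>\<close> at the left end, and this is the point to which the backward pass jumps.\<close>

lemma merge_value_at_start:
  assumes "chain l L u" "h l = \<phi> l"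
    and "\<And>p q. (p, q) \<in> set L \<Longrightarrow> h constant_on {p..q} \<or> (\<forall>y\<in>{p..q}. h y = \<phi> y)"
    and "(p, q) \<in> set (merge h L)"
  shows "h p = \<phi> p"
  using assms
proof (induction h L arbitrary: l rule: merge.induct)
  case (1 h p1 q1 q1' r L)
  have c: "p1 = l" "q1' = q1" "p1 < q1" "q1 < r" "chain p1 ((p1, r) # L) u" "chain q1 ((q1, r) # L) u"
    using 1(3) by auto
  show ?case
  proof (cases "h constant_on {p1..q1} \<and> h constant_on {q1..r}")
    case True
    then have "h constant_on {p1..r}" using constant_on_Icc_join[of h p1 q1 r] c by simp
    then have "\<And>p q. (p, q) \<in> set ((p1, r) # L) \<Longrightarrow>
        h constant_on {p..q} \<or> (\<forall>y\<in>{p..q}. h y = \<phi> y)"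
      using 1(5) by auto
    moreover have "(p, q) \<in> set (merge h ((p1, r) # L))" using 1(6) True c by simp
    moreover have "h p1 = \<phi> p1" using 1(4) c(1) by simp
    ultimately show ?thesis using 1(1)[OF _ c(5)] True c(2) by blast
  next
    case False
    \<comment> \<open>One of the two intervals is a copy of \<open>\<phi>\<close>, and \<open>q1\<close> belongs to both.\<close>
    have "h constant_on {p1..q1} \<or> (\<forall>y\<in>{p1..q1}. h y = \<phi> y)"
      "h constant_on {q1..r} \<or> (\<forall>y\<in>{q1..r}. h y = \<phi> y)"
      using 1(5)[of p1 q1] 1(5)[of q1' r] c(2) by simp_all
    then have "h q1 = \<phi> q1" using False c(3,4) by auto
    moreover have "\<And>p q. (p, q) \<in> set ((q1, r) # L) \<Longrightarrow>
        h constant_on {p..q} \<or> (\<forall>y\<in>{p..q}. h y = \<phi> y)" using 1(5) c(2) by auto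
    moreover have "(p, q) = (p1, q1) \<or> (p, q) \<in> set (merge h ((q1, r) # L))"
      using False 1(6) c(2) by auto
    ultimately show ?thesis using 1(2)[OF _ c(6)[folded c(2)]] False c(1,2) 1(4) by blast
  qed
qed auto

text \<open>Continuity and the form of \<^term>\<open>\<phi>\<close> are recorded where \<^term>\<open>h\<close> copies \<^term>\<open>\<phi>\<close>, because \<^term>\<open>h\<close> then passes
them on to the next stage.\<close>

definition piece :: "(real \<Rightarrow> real) \<Rightarrow> real \<Rightarrow> (real \<Rightarrow> real) \<Rightarrow> (real \<Rightarrow> real) \<Rightarrow> real \<Rightarrow> real \<Rightarrow> bool" where
  "piece U B \<phi> h p q \<longleftrightarrow> h constant_on {p..q} \<or>
     ((\<forall>y\<in>{p..q}. h y = \<phi> y) \<and> continuous_on {p..q} \<phi> \<and> zeta_form U B \<phi> p q)"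

text \<open>The state of a sweep that has reached \<^term>\<open>t\<close>.  Of the property that $h(z)$ is the minimum of \<^term>\<open>\<phi>\<close> on
$[l, z]$, only the lower bound is stated for all points.  That it is attained is needed only at the
points which the backward pass visits, and there it follows from the values at the left ends of
constant intervals and from \<^term>\<open>h\<close> being a copy of \<^term>\<open>\<phi>\<close> on the others.\<close>

definition sweep_inv where
  "sweep_inv U B \<phi> l t h L \<longleftrightarrow>
     h l = \<phi> l \<and> chain l L t \<and> (\<forall>(p, q)\<in>set L. piece U B \<phi> h p q \<and> h p = \<phi> p) \<and>
     (\<forall>y z. l \<le> y \<longrightarrow> y \<le> z \<longrightarrow> z \<le> t \<longrightarrow> h z \<le> \<phi> y)"

lemma piece_cong:
  assumes "\<And>y. y \<in> {p..q} \<Longrightarrow> h' y = h y"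
  shows "piece U B \<phi> h' p q = piece U B \<phi> h p q"
proof -
  have "h' constant_on {p..q} \<longleftrightarrow> h constant_on {p..q}" using assms by (simp add: constant_on_def)
  then show ?thesis using assms by (simp add: piece_def)
qed

text \<open>One update overwrites \<^term>\<open>h\<close> on $[p, q]$ and leaves it unchanged up to \<^term>\<open>p\<close>, because the update starts
with the old value \<^term>\<open>h p\<close>.  A new value is bounded by $h(p)$, which bounds \<^term>\<open>\<phi>\<close> on $[l, p]$, and by
the values of \<^term>\<open>\<phi>\<close> on the part of $[p, q]$ already passed.\<close>

lemma sweep_inv_step:
  assumes inv: "sweep_inv U B \<phi> l p h L" and up: "update p q \<phi> (h p) \<theta> Q" and "p < q"
    and \<phi>: "continuous_on {p..q} \<phi>" "zeta_form U B \<phi> p q"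
    and h': "h' = (\<lambda>y. if y \<in> {p..q} then \<theta> y else h y)"
  shows "sweep_inv U B \<phi> l q h' (merge h' (L @ Q))"
proof -
  note u = update_spec[OF up \<open>p < q\<close>]
  have i: "h l = \<phi> l" "chain l L p" "\<And>s t. (s, t) \<in> set L \<Longrightarrow> piece U B \<phi> h s t"
    "\<And>y z. l \<le> y \<Longrightarrow> y \<le> z \<Longrightarrow> z \<le> p \<Longrightarrow> h z \<le> \<phi> y"
    using inv by (auto simp: sweep_inv_def)
  have lp: "l \<le> p" using chain_le i(2) by blast
  have old: "h' y = h y" if "y \<le> p" for y using that u(1) h' by auto
  have new: "h' y = \<theta> y" if "y \<in> {p..q}" for y using that h' by auto
  have ch: "chain l (L @ Q) q" using i(2) u(2) chain_append by blast
  have "h' l = \<phi> l" using old lp i(1) by simp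
  moreover have P: "piece U B \<phi> h' s t" if "(s, t) \<in> set (L @ Q)" for s t
  proof (cases "(s, t) \<in> set L")
    case True
    then have "t \<le> p" using chain_subset[OF i(2)] by blast
    then show ?thesis using i(3)[OF True] piece_cong[of s t h' h] old by simp
  next
    case False
    then have Q: "(s, t) \<in> set Q" using that by simp
    then have st: "{s..t} \<subseteq> {p..q}" using chain_subset[OF u(2)] by auto
    have "piece U B \<phi> \<theta> s t"
      using u(5)[OF Q] zeta_form_subinterval[OF \<phi>(2) st] continuous_on_subset[OF \<phi>(1) st]
      unfolding piece_def by blast
    moreover have "\<And>y. y \<in> {s..t} \<Longrightarrow> h' y = \<theta> y" using st new by blast
    ultimately show ?thesis using piece_cong by blast
  qed
  moreover have "piece U B \<phi> h' s t" if "(s, t) \<in> set (merge h' (L @ Q))" for s t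
    by (rule merge_preserves[OF ch P _ that]) (auto simp: piece_def)
  moreover have "h' s = \<phi> s" if "(s, t) \<in> set (merge h' (L @ Q))" for s t
    by (rule merge_value_at_start[where h = h' and \<phi> = \<phi>, OF ch _ _ that])
      (use P \<open>h' l = \<phi> l\<close> in \<open>auto simp: piece_def\<close>)
  moreover have "h' z \<le> \<phi> y" if yz: "l \<le> y" "y \<le> z" "z \<le> q" for y z
  proof (cases "z \<le> p")
    case True
    then show ?thesis using old i(4) yz by simp
  next
    case False
    then have z: "z \<in> {p..q}" using yz by simp
    show ?thesis
    proof (cases "p \<le> y")
      case True
      then show ?thesis using u(4)[OF True yz(2,3)] new[OF z] by simp
    next
      case False
      then have "h p \<le> \<phi> y" using i(4) yz by simp
      then show ?thesis using u(3)[OF z] new[OF z] by simp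
    qed
  qed
  ultimately show ?thesis unfolding sweep_inv_def using chain_merge[OF ch] by blast
qed

lemma sweep_sound:
  assumes "sweep \<phi> T (h, L) (h', L')" "sweep_inv U B \<phi> l t h L" "chain t T u"
    and "\<And>p q. (p, q) \<in> set T \<Longrightarrow> continuous_on {p..q} \<phi> \<and> zeta_form U B \<phi> p q"
  shows "sweep_inv U B \<phi> l u h' L'"
  using assms
proof (induction T "(h, L)" "(h', L')" arbitrary: h L t rule: sweep.induct)
  case (2 p q h \<theta> Q h1 T L)
  then have c: "p = t" "p < q" "chain q T u" by auto
  have "sweep_inv U B \<phi> l q h1 (merge h1 (L @ Q))"
    using sweep_inv_step 2 c by simp
  then show ?case using 2 c by simp
qed auto

text \<open>An update can fail only if its start value exceeds the value of \<^term>\<open>\<phi>\<close> there, and every update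
ends with a value at most that of \<^term>\<open>\<phi>\<close>.\<close>

lemma sweep_exists:
  assumes "chain t T u" "h t \<le> \<phi> t"
    and "\<And>p q. (p, q) \<in> set T \<Longrightarrow>
      continuous_on {p..q} \<phi> \<and> (strict_mono_on {p..q} \<phi> \<or> strict_antimono_on {p..q} \<phi>)"
  shows "\<exists>hL. sweep \<phi> T (h, L) hL"
  using assms
proof (induction t T u arbitrary: h L rule: chain.induct)
  case (1 l u)
  then show ?case using sweep.intros(1) by blast
next
  case (2 l p q T u)
  have c: "p = l" "p < q" "chain q T u" using 2(2) by auto
  have \<phi>: "continuous_on {p..q} \<phi>" "strict_mono_on {p..q} \<phi> \<or> strict_antimono_on {p..q} \<phi>"
    using 2(4)[of p q] by auto
  obtain \<theta> Q where up: "update p q \<phi> (h p) \<theta> Q"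
    using update_exists[OF \<phi>(1) _ c(2) \<phi>(2)] 2(3) c(1) by blast
  define h' where "h' = (\<lambda>y. if y \<in> {p..q} then \<theta> y else h y)"
  have "h' q \<le> \<phi> q" using update_spec(4)[OF up c(2), of q q] c(2) by (simp add: h'_def)
  then obtain hL where "sweep \<phi> T (h', merge h' (L @ Q)) hL"
    using 2(1)[OF c(3), of h'] 2(4) by fastforce
  then show ?case using sweep.intros(2)[OF up h'_def] by blast
qed

text \<open>What a forward step requires of its input.  Its output, to which the next $f_i$ is added, satisfies
the condition again.\<close>

definition admissible where
  "admissible U B l u \<phi> L \<longleftrightarrow>
     chain l L u \<and> (\<forall>(p, q)\<in>set L. continuous_on {p..q} \<phi> \<and> zeta_form U B \<phi> p q)"

lemma decompose_pieces:
  assumes "admissible U B l u \<phi> L" "list_all2 (decompose U B \<phi>) L Ts"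
  shows "chain l (concat Ts) u"
    and "\<And>s t. (s, t) \<in> set (concat Ts) \<Longrightarrow> continuous_on {s..t} \<phi> \<and> zeta_form U B \<phi> s t \<and>
      (strict_mono_on {s..t} \<phi> \<or> strict_antimono_on {s..t} \<phi>)"
proof -
  show "chain l (concat Ts) u"
    using chain_concat[OF assms(2) decompose_chain(1)] assms(1) by (auto simp: admissible_def)
  show "continuous_on {s..t} \<phi> \<and> zeta_form U B \<phi> s t \<and>
      (strict_mono_on {s..t} \<phi> \<or> strict_antimono_on {s..t} \<phi>)" if st: "(s, t) \<in> set (concat Ts)" for s t
  proof -
    obtain T where T: "T \<in> set Ts" "(s, t) \<in> set T" using st by auto
    then obtain i where i: "i < length L" "(s, t) \<in> set (Ts ! i)"
      using list_all2_lengthD[OF assms(2)] by (metis in_set_conv_nth)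
    obtain p q where pq: "L ! i = (p, q)" by (cases "L ! i")
    then have L: "(p, q) \<in> set L" using i(1) by (metis nth_mem)
    have d: "decompose U B \<phi> (p, q) (Ts ! i)"
      using list_all2_nthD[OF assms(2) i(1)] pq by simp
    have \<phi>: "continuous_on {p..q} \<phi>" "zeta_form U B \<phi> p q" "p < q"
      using assms(1) L chain_subset[of l L u p q] unfolding admissible_def by auto
    have sub: "{s..t} \<subseteq> {p..q}" using chain_subset[OF decompose_chain(1)[OF d \<phi>(3)] i(2)] by auto
    show ?thesis
      using strict_monotone_between_cut_points[OF \<phi>(1) sub decompose_chain(2)[OF d \<phi>(3) i(2)]]
        zeta_form_subinterval[OF \<phi>(2) sub] continuous_on_subset[OF \<phi>(1) sub] by blast
  qed
qed

lemma forward_step_sound: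
  assumes "admissible U B l u \<phi> L" "forward_step U B l \<phi> L h' L'"
  shows "sweep_inv U B \<phi> l u h' L'"
proof -
  obtain Ts where Ts: "list_all2 (decompose U B \<phi>) L Ts"
    "sweep \<phi> (concat Ts) ((\<lambda>_. 0)(l := \<phi> l), []) (h', L')"
    using assms(2) unfolding forward_step_def by blast
  have "sweep_inv U B \<phi> l l ((\<lambda>_. 0)(l := \<phi> l)) []"
    unfolding sweep_inv_def by (auto dest: antisym)
  then show ?thesis
    using sweep_sound[OF Ts(2)] decompose_pieces[OF assms(1) Ts(1)] by blast
qed

lemma forward_step_exists:
  assumes U: "s_shaped_utility U B" and ad: "admissible U B l u \<phi> L"
  shows "\<exists>h' L'. forward_step U B l \<phi> L h' L'"
proof -
  have "\<exists>Q. decompose U B \<phi> I Q" if "I \<in> set L" for I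
  proof -
    obtain p q where I: "I = (p, q)" by (cases I)
    then have "zeta_form U B \<phi> p q" using that ad by (auto simp: admissible_def)
    then show ?thesis using finite_cut_points[OF U]
      unfolding I decompose_def Let_def by (auto simp: zeta_form_def)
  qed
  then obtain D where "\<And>I. I \<in> set L \<Longrightarrow> decompose U B \<phi> I (D I)" by metis
  then have Ts: "list_all2 (decompose U B \<phi>) L (map D L)"
    by (simp add: list_all2_conv_all_nth)
  have "\<exists>hL. sweep \<phi> (concat (map D L)) ((\<lambda>_. 0)(l := \<phi> l), []) hL"
    by (rule sweep_exists) (use decompose_pieces[OF ad Ts] in auto)
  then show ?thesis using Ts unfolding forward_step_def by (metis surj_pair)
qed

lemma admissible_next:
  assumes inv: "sweep_inv U B \<phi> l u h L" and pos: "a > 0" "b > 0" "s > 0"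
    and cont: "continuous_on UNIV (zeta U B a b w s)"
  shows "admissible U B l u (\<lambda>y. zeta U B a b w s y + h y) L"
proof -
  have "continuous_on {p..q} h \<and> (h constant_on {p..q} \<or> zeta_form U B h p q)"
    if "(p, q) \<in> set L" for p q
  proof -
    have "piece U B \<phi> h p q" using inv that by (auto simp: sweep_inv_def)
    then show ?thesis unfolding piece_def
    proof
      assume "h constant_on {p..q}"
      then show ?thesis
        unfolding constant_on_def by (metis continuous_on_cong continuous_on_const)
    next
      assume "(\<forall>y\<in>{p..q}. h y = \<phi> y) \<and> continuous_on {p..q} \<phi> \<and> zeta_form U B \<phi> p q"
      then show ?thesis
        using zeta_form_cong[of p q h \<phi>] continuous_on_cong[of "{p..q}" "{p..q}" h \<phi>] by blast
    qed
  qed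
  moreover have "continuous_on {p..q} (zeta U B a b w s)" for p q
    using cont continuous_on_subset by blast
  ultimately show ?thesis
    using inv zeta_form_zeta_plus[OF pos]
    by (auto simp: admissible_def sweep_inv_def intro!: continuous_on_add)
qed


section \<open>Restricting the problem to a box\<close>

text \<open>Continuity at \<^term>\<open>B\<close> allows the weight to change there only if $U(B) = 0$.  So at \<^term>\<open>B\<close> both weights
give the same value.\<close>

lemma weights_agree_at_jump:
  assumes "continuous_on UNIV U" "continuous_on UNIV (zeta U B a b w s)"
  shows "a * U B = b * U B"
proof -
  let ?g = "\<lambda>y. - b * U y + s / 2 * (y - w)\<^sup>2"
  have "(zeta U B a b w s \<longlongrightarrow> zeta U B a b w s B) (at_right B)"
    using assms(2) by (meson UNIV_I continuous_on_def filterlim_mono at_le subset_UNIV order_refl)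
  moreover have "\<forall>\<^sub>F y in at_right B. zeta U B a b w s y = ?g y"
    by (rule eventually_mono[OF eventually_at_right_less]) (simp add: zeta_def)
  ultimately have "(?g \<longlongrightarrow> zeta U B a b w s B) (at_right B)"
    using tendsto_cong by fast
  moreover have "continuous_on UNIV ?g" using assms(1) by (intro continuous_intros)
  then have "(?g \<longlongrightarrow> ?g B) (at_right B)"
    by (meson UNIV_I continuous_on_def filterlim_mono at_le subset_UNIV order_refl)
  ultimately have "zeta U B a b w s B = ?g B" by (rule tendsto_unique[OF trivial_limit_at_right_real])
  then show ?thesis by (simp add: zeta_def)
qed

text \<open>To the left of \<^term>\<open>w\<close> both the weighted negative utility and the square decrease.  If the weight changes
between the two points, the comparison goes through \<^term>\<open>B\<close>.\<close>

lemma zeta_decreasing: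
  assumes "s_shaped_utility U B" "continuous_on UNIV (zeta U B a b w s)"
    and pos: "a > 0" "b > 0" "s > 0" and xy: "x \<le> y" "y \<le> w"
  shows "zeta U B a b w s y \<le> zeta U B a b w s x"
proof -
  have U: "U v \<le> U v'" if "v \<le> v'" for v v'
    using assms(1) that by (auto simp: s_shaped_utility_def strict_mono_less_eq)
  have "a * U B = b * U B"
    using assms(1,2) weights_agree_at_jump by (auto simp: s_shaped_utility_def)
  then have jump: "a * U x \<le> b * U y" if "x \<le> B" "B \<le> y"
    using mult_left_mono[OF U[OF that(1)], of a] mult_left_mono[OF U[OF that(2)], of b] pos by linarith
  have weights: "(if x \<le> B then a else b) * U x \<le> (if y \<le> B then a else b) * U y"
  proof (cases "x \<le> B \<and> B < y")
    case True
    then show ?thesis using jump by simp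
  next
    case False
    then have "(if x \<le> B then a else b) = (if y \<le> B then a else b)" using xy(1) by auto
    then show ?thesis using U[OF xy(1)] pos by (simp add: mult_left_mono)
  qed
  have "(y - w)\<^sup>2 \<le> (x - w)\<^sup>2" using xy by (simp add: abs_le_square_iff[symmetric])
  then have "s / 2 * (y - w)\<^sup>2 \<le> s / 2 * (x - w)\<^sup>2" using pos by (intro mult_left_mono) auto
  then show ?thesis using weights by (simp add: zeta_def)
qed

lemma deriv_utility_decreasing_above:
  assumes U: "s_shaped_utility U B" and "B < x" "x \<le> y"
  shows "deriv U y \<le> deriv U x"
proof (rule DERIV_nonpos_imp_nonincreasing[OF assms(3)])
  fix v assume "x \<le> v" "v \<le> y"
  then have "v > B" using assms by simp
  then have "((deriv U) has_real_derivative (deriv ^^ 2) U v) (at v)" "(deriv ^^ 2) U v < 0"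
    using s_shaped_deriv[OF U, of v 1] U by (auto simp: numeral_2_eq_2 s_shaped_utility_def)
  then show "\<exists>d. DERIV (deriv U) v :> d \<and> d \<le> 0" by (meson less_imp_le)
qed

lemma deriv_utility_pos_above:
  assumes U: "s_shaped_utility U B" and "B < x"
  shows "deriv U x > 0"
proof -
  have "\<exists>z. x < z \<and> z < x + 1 \<and> U (x + 1) - U x = (x + 1 - x) * deriv U z"
    by (rule MVT2) (use s_shaped_deriv[OF U, of _ 0] assms(2) in auto)
  then obtain z where z: "x < z" "U (x + 1) - U x = deriv U z" by auto
  moreover have "U x < U (x + 1)" using U by (auto simp: s_shaped_utility_def strict_mono_less)
  ultimately show ?thesis using deriv_utility_decreasing_above[OF U assms(2), of z] by simp
qed

text \<open>Beyond $B + 1$ the marginal utility is at most $U'(B+1)$, so the derivative is at least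
$s (y - w) - b U'(B+1)$.  The second bound on \<^term>\<open>v\<close> is where this becomes nonnegative.\<close>

lemma zeta_increasing:
  assumes U: "s_shaped_utility U B" and pos: "b > 0" "s > 0"
    and v: "B + 1 \<le> v" "w + b * deriv U (B + 1) / s \<le> v" and "v \<le> x"
  shows "zeta U B a b w s v \<le> zeta U B a b w s x"
proof (rule DERIV_nonneg_imp_nondecreasing[OF \<open>v \<le> x\<close>])
  fix y assume y: "v \<le> y" "y \<le> x"
  have "b * deriv U y \<le> b * deriv U (B + 1)"
    using deriv_utility_decreasing_above[OF U, of "B + 1" y] y v pos by (intro mult_left_mono) auto
  also have "\<dots> \<le> s * (v - w)" using v(2) pos by (simp add: field_simps)
  also have "\<dots> \<le> s * (y - w)" using y(1) pos by (intro mult_left_mono) auto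
  finally have "0 \<le> - b * deriv U y + s * (y - w)" by simp
  moreover have "(zeta U B a b w s has_real_derivative - b * deriv U y + s * (y - w)) (at y)"
    using zeta_deriv[OF U, of y a b w s] y v by simp
  ultimately show "\<exists>d. DERIV (zeta U B a b w s) y :> d \<and> 0 \<le> d" by blast
qed

section \<open>Dynamic programming\<close>

text \<open>The backward choice makes the lower bound an equality: on a constant interval the value of \<^term>\<open>h\<close> is
attained by \<^term>\<open>\<phi>\<close> at the left end, and elsewhere at \<^term>\<open>y\<close> itself.\<close>

lemma backward_step:
  assumes inv: "sweep_inv U B \<phi> l u h L" and pq: "(p, q) \<in> set L" "y \<in> {p..q}"
    and y': "y' = (if h constant_on {p..q} then p else y)"
  shows "h y = \<phi> y'" and "l \<le> y'" and "y' \<le> y"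
proof -
  have p: "piece U B \<phi> h p q" "h p = \<phi> p" "l \<le> p"
    using inv pq chain_subset unfolding sweep_inv_def by blast+
  show "h y = \<phi> y'"
  proof (cases "h constant_on {p..q}")
    case True
    then obtain c where "\<And>v. v \<in> {p..q} \<Longrightarrow> h v = c" unfolding constant_on_def by blast
    then have "h y = h p" using pq(2) by auto
    then show ?thesis using True p y' by simp
  next
    case False
    then show ?thesis using p pq(2) y' by (simp add: piece_def)
  qed
  show "l \<le> y'" "y' \<le> y" using p(3) pq(2) y' by auto
qed

locale isotonic_utility_problem =
  fixes U :: "real \<Rightarrow> real" and B \<sigma> :: real and N :: nat and w a b :: "nat \<Rightarrow> real"
  assumes utility: "s_shaped_utility U B"
    and N: "N \<ge> 1"
    and \<sigma>: "\<sigma> > 0"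
    and w_mono: "mono_on {1..N} w"
    and a: "\<And>i. i \<in> {1..N} \<Longrightarrow> a i > 0"
    and b: "\<And>i. i \<in> {1..N} \<Longrightarrow> b i > 0"
    and cont: "\<And>i. i \<in> {1..N} \<Longrightarrow> continuous_on UNIV (zeta U B (a i) (b i) (w i) \<sigma>)"
begin

definition f :: "nat \<Rightarrow> real \<Rightarrow> real" where "f i = zeta U B (a i) (b i) (w i) \<sigma>"

definition u :: real where "u = upper_bound U B N \<sigma> w b"

abbreviation "l \<equiv> w 1"

text \<open>The function that the forward pass sweeps in stage \<^term>\<open>n\<close>: the least cost of the first \<^term>\<open>n\<close> variables as a
function of the value of the last one.\<close>

abbreviation "bellman h n \<equiv> (\<lambda>y. f n y + h n y)"

lemma u_ge:
  assumes "i \<in> {1..N}"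
  shows "B + 1 \<le> u" and "w i + b i * deriv U (B + 1) / \<sigma> \<le> u"
proof -
  have "max (B + 1) (w i + b i * deriv U (B + 1) / \<sigma>) \<le> u"
    unfolding u_def upper_bound_def using assms by (intro Max_ge) auto
  then show "B + 1 \<le> u" and "w i + b i * deriv U (B + 1) / \<sigma> \<le> u" by auto
qed

lemma l_less_u: "l < u"
proof -
  have 1: "1 \<in> {1..N}" using N by simp
  have "b 1 * deriv U (B + 1) / \<sigma> > 0"
    using b[OF 1] \<sigma> deriv_utility_pos_above[OF utility, of "B + 1"] by simp
  then show ?thesis using u_ge(2)[OF 1] by linarith
qed

text \<open>Left of \<^term>\<open>l\<close> every \<^term>\<open>f i\<close> is decreasing because \<^term>\<open>l\<close> is the smallest of the $w_i$, and right of
\<^term>\<open>u\<close> every \<^term>\<open>f i\<close> is increasing.\<close>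

lemma f_clamp_le:
  assumes i: "i \<in> {1..N}"
  shows "f i (max l (min u x)) \<le> f i x"
proof -
  consider "x \<le> l" | "l \<le> x" "x \<le> u" | "u \<le> x" by linarith
  then show ?thesis
  proof cases
    case 1
    have "l \<le> w i" using w_mono i by (auto intro: mono_onD)
    then have "f i l \<le> f i x"
      unfolding f_def using 1 a b i \<sigma> cont by (intro zeta_decreasing[OF utility]) auto
    then show ?thesis using 1 l_less_u by (simp add: max_def min_def)
  next
    case 2
    then show ?thesis by (simp add: max_def min_def)
  next
    case 3
    have "f i u \<le> f i x"
      unfolding f_def using 3 b i \<sigma> u_ge[OF i] by (intro zeta_increasing[OF utility]) auto
    then show ?thesis using 3 l_less_u by (simp add: max_def min_def)
  qed
qed

lemma admissible_initial: "admissible U B l u (\<lambda>y. f 1 y + 0) [(l, u)]"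
proof -
  have 1: "1 \<in> {1..N}" using N by simp
  have "zeta_form U B (\<lambda>y. f 1 y + 0) l u"
    unfolding f_def using zeta_form_zeta_plus[of "a 1" "b 1" \<sigma> "\<lambda>_. 0" l u U B "w 1"] a[OF 1] b[OF 1] \<sigma>
    by (auto simp: constant_on_def)
  moreover have "continuous_on {l..u} (f 1)"
    using cont[OF 1] continuous_on_subset unfolding f_def by blast
  ultimately show ?thesis using l_less_u by (auto simp: admissible_def)
qed

lemma admissible_Suc:
  assumes "sweep_inv U B \<phi> l u h L" "n \<in> {1..N}"
  shows "admissible U B l u (\<lambda>y. f n y + h y) L"
  using admissible_next[OF assms(1)] a b \<sigma> cont assms(2) unfolding f_def by blast

lemma forward_pass_invariant:
  assumes fp: "forward_pass U B N f l u h L" and "n \<in> {1..N}"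
  shows "sweep_inv U B (bellman h n) l u (h (Suc n)) (L (Suc n))"
proof -
  have step: "forward_step U B l (bellman h n) (L n) (h (Suc n)) (L (Suc n))" if "n \<in> {1..N}" for n
    using fp that unfolding forward_pass_def by (auto dest!: bspec[of _ _ "Suc n"])
  have "admissible U B l u (bellman h n) (L n)"
    using assms(2)
  proof (induction n)
    case (Suc n)
    show ?case
    proof (cases "n = 0")
      case True
      then show ?thesis using fp admissible_initial by (simp add: forward_pass_def)
    next
      case False
      then show ?thesis using Suc admissible_Suc[OF forward_step_sound[OF _ step]] by simp
    qed
  qed simp
  then show ?thesis using forward_step_sound step assms(2) by blast
qed

lemma forward_pass_exists: "\<exists>h L. forward_pass U B N f l u h L"
proof -
  \<comment> \<open>The pair with index \<open>k\<close> holds the function and the list of stage \<open>k + 1\<close>.\<close>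
  define P where "P k x \<longleftrightarrow> (k = 0 \<longrightarrow> x = (\<lambda>_. 0, [(l, u)])) \<and>
    (Suc k \<le> N \<longrightarrow> admissible U B l u (\<lambda>y. f (Suc k) y + fst x y) (snd x))"
    for k :: nat and x :: "(real \<Rightarrow> real) \<times> (real \<times> real) list"
  define Q where "Q k x x' \<longleftrightarrow> (Suc k \<le> N \<longrightarrow>
    forward_step U B l (\<lambda>y. f (Suc k) y + fst x y) (snd x) (fst x') (snd x'))"
    for k :: nat and x x' :: "(real \<Rightarrow> real) \<times> (real \<times> real) list"
  have "\<exists>F. \<forall>k. P k (F k) \<and> Q k (F k) (F (Suc k))"
  proof (rule dependent_nat_choice)
    show "\<exists>x. P 0 x" using admissible_initial by (auto simp: P_def)
    show "\<exists>x'. P (Suc k) x' \<and> Q k x x'" if "P k x" for x k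
    proof (cases "Suc k \<le> N")
      case True
      then have ad: "admissible U B l u (\<lambda>y. f (Suc k) y + fst x y) (snd x)"
        using that by (simp add: P_def)
      then obtain h' L' where st: "forward_step U B l (\<lambda>y. f (Suc k) y + fst x y) (snd x) h' L'"
        using forward_step_exists[OF utility] by blast
      then have "P (Suc k) (h', L')"
        using admissible_Suc[OF forward_step_sound[OF ad st]] by (simp add: P_def)
      moreover have "Q k x (h', L')" using st by (simp add: Q_def)
      ultimately show ?thesis by blast
    next
      case False
      then show ?thesis by (auto simp: P_def Q_def)
    qed
  qed
  then obtain F where F: "\<And>k. P k (F k)" "\<And>k. Q k (F k) (F (Suc k))" by blast
  have "forward_step U B l (\<lambda>y. f (n - 1) y + fst (F (n - 1 - 1)) y) (snd (F (n - 1 - 1)))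
      (fst (F (n - 1))) (snd (F (n - 1)))" if "n \<in> {2..N + 1}" for n
  proof -
    obtain k where "n = Suc (Suc k)" using \<open>n \<in> {2..N + 1}\<close> by (metis atLeastAtMost_iff add_2_eq_Suc le_Suc_ex)
    then show ?thesis using F(2)[of k] that by (simp add: Q_def)
  qed
  moreover have "F 0 = (\<lambda>_. 0, [(l, u)])" using F(1)[of 0] by (simp add: P_def)
  ultimately have "forward_pass U B N f l u (\<lambda>n. fst (F (n - 1))) (\<lambda>n. snd (F (n - 1)))"
    unfolding forward_pass_def by simp
  then show ?thesis by blast
qed

lemma backward_pass_exists:
  assumes fp: "forward_pass U B N f l u h L"
  shows "\<exists>y. backward_pass N u h L y"
proof -
  \<comment> \<open>The pass runs downwards: the value with index \<open>j\<close> is \<open>y (N + 1 - j)\<close>.\<close>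
  define Q where "Q j v v' \<longleftrightarrow> (j < N \<longrightarrow> (\<exists>(p, q)\<in>set (L (N + 1 - j)). v \<in> {p..q} \<and>
    v' = (if h (N + 1 - j) constant_on {p..q} then p else v)))" for j :: nat and v v' :: real
  have "\<exists>g. \<forall>j. (g j \<in> {l..u} \<and> (j = 0 \<longrightarrow> g j = u)) \<and> Q j (g j) (g (Suc j))"
  proof (rule dependent_nat_choice)
    show "\<exists>x. x \<in> {l..u} \<and> ((0::nat) = 0 \<longrightarrow> x = u)" using l_less_u by auto
    show "\<exists>v'. (v' \<in> {l..u} \<and> (Suc j = 0 \<longrightarrow> v' = u)) \<and> Q j v v'"
      if v: "v \<in> {l..u} \<and> (j = 0 \<longrightarrow> v = u)" for v j
    proof (cases "j < N")
      case True
      then have inv: "sweep_inv U B (bellman h (N - j)) l u (h (N + 1 - j)) (L (N + 1 - j))"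
        using forward_pass_invariant[OF fp, of "N - j"] by (simp add: Suc_diff_le)
      then obtain p q where pq: "(p, q) \<in> set (L (N + 1 - j))" "v \<in> {p..q}"
        using chain_covers[of l "L (N + 1 - j)" u v] l_less_u v unfolding sweep_inv_def by blast
      define v' where "v' = (if h (N + 1 - j) constant_on {p..q} then p else v)"
      have "v' \<in> {l..u}" using backward_step[OF inv pq v'_def] v by auto
      moreover have "Q j v v'" using pq v'_def unfolding Q_def by blast
      ultimately show ?thesis by auto
    next
      case False
      then show ?thesis using l_less_u by (auto simp: Q_def)
    qed
  qed
  then obtain g where g: "g 0 = u" "\<And>j. Q j (g j) (g (Suc j))" by blast
  have "\<exists>(p, q)\<in>set (L n). g (N + 1 - n) \<in> {p..q} \<and>
      g (N + 1 - (n - 1)) = (if h n constant_on {p..q} then p else g (N + 1 - n))"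
    if n: "n \<in> {2..N + 1}" for n
  proof -
    have "N + 1 - (n - 1) = Suc (N + 1 - n)" "N + 1 - (N + 1 - n) = n" "N + 1 - n < N" using n by auto
    then show ?thesis using g(2)[of "N + 1 - n"] unfolding Q_def by simp
  qed
  then have "backward_pass N u h L (\<lambda>n. g (N + 1 - n))"
    using g(1) unfolding backward_pass_def by simp
  then show ?thesis by blast
qed

text \<open>The value function is a lower bound for the cost of all monotone choices of the first \<^term>\<open>n\<close> variables
between \<^term>\<open>l\<close> and \<^term>\<open>z\<close>; the constraints couple only neighbours, so each stage needs just
the last variable.\<close>

lemma bellman_lower_bound:
  assumes fp: "forward_pass U B N f l u h L"
    and x: "\<And>i. i \<in> {1..N} \<Longrightarrow> l \<le> x i" "mono_on {1..N} x"
  shows "n \<le> N \<Longrightarrow> z \<le> u \<Longrightarrow> (n \<ge> 1 \<Longrightarrow> x n \<le> z) \<Longrightarrow> h (Suc n) z \<le> (\<Sum>i=1..n. f i (x i))"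
proof (induction n arbitrary: z)
  case 0
  then show ?case using fp by (simp add: forward_pass_def)
next
  case (Suc n)
  have n: "Suc n \<in> {1..N}" using Suc by simp
  have "h (Suc (Suc n)) z \<le> f (Suc n) (x (Suc n)) + h (Suc n) (x (Suc n))"
    using forward_pass_invariant[OF fp n] x(1)[OF n] Suc.prems by (simp add: sweep_inv_def)
  also have "h (Suc n) (x (Suc n)) \<le> (\<Sum>i=1..n. f i (x i))"
  proof (rule Suc.IH)
    show "x n \<le> x (Suc n)" if "n \<ge> 1" using x(2) that n by (auto intro: mono_onD)
  qed (use Suc.prems in auto)
  finally show ?case by simp
qed

lemma backward_pass_value:
  assumes fp: "forward_pass U B N f l u h L" and bp: "backward_pass N u h L y"
  shows "n \<in> {1..N} \<Longrightarrow> y n \<le> y (Suc n)"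
    and "n \<le> N \<Longrightarrow> h (Suc n) (y (Suc n)) = (\<Sum>i=1..n. f i (y i))"
proof -
  have step: "h (Suc n) (y (Suc n)) = f n (y n) + h n (y n) \<and> y n \<le> y (Suc n)" if n: "n \<in> {1..N}" for n
  proof -
    have bp': "\<forall>n\<in>{2..N + 1}. \<exists>(p, q)\<in>set (L n). y n \<in> {p..q} \<and>
        y (n - 1) = (if h n constant_on {p..q} then p else y n)"
      using bp unfolding backward_pass_def by (rule conjunct2)
    have "Suc n \<in> {2..N + 1}" using n by simp
    from bspec[OF bp' this] obtain p q where pq: "(p, q) \<in> set (L (Suc n))" "y (Suc n) \<in> {p..q}"
      and yn: "y n = (if h (Suc n) constant_on {p..q} then p else y (Suc n))"
      by auto
    show ?thesis
      using backward_step(1,3)[OF forward_pass_invariant[OF fp n] pq yn] by (rule conjI)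
  qed
  then show "n \<in> {1..N} \<Longrightarrow> y n \<le> y (Suc n)" by (rule conjunct2)
  show "n \<le> N \<Longrightarrow> h (Suc n) (y (Suc n)) = (\<Sum>i=1..n. f i (y i))"
  proof (induction n)
    case 0
    then show ?case using fp by (simp add: forward_pass_def)
  next
    case (Suc n)
    then show ?case using conjunct1[OF step[of "Suc n"]] by simp
  qed
qed

text \<open>The cost of the returned point is $h_{N+1}(u)$, which bounds the cost of every feasible point in the box.
Any other feasible point stays monotone and gets no more expensive when its entries are clamped to the box.\<close>

lemma backward_pass_optimal:
  assumes fp: "forward_pass U B N f l u h L" and bp: "backward_pass N u h L y"
  shows "mono_on {1..N} y" and "mono_on {1..N} x \<Longrightarrow> (\<Sum>i=1..N. f i (y i)) \<le> (\<Sum>i=1..N. f i (x i))"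
proof -
  show "mono_on {1..N} y"
  proof (rule mono_onI)
    fix i j assume ij: "i \<in> {1..N}" "j \<in> {1..N}" "i \<le> j"
    from ij(3,2) show "y i \<le> y j"
    proof (induction j rule: dec_induct)
      case (step k)
      then have "y i \<le> y k" "k \<in> {1..N}" using ij(1) by auto
      then show ?case using backward_pass_value(1)[OF fp bp] order_trans by blast
    qed simp
  qed
  show "(\<Sum>i=1..N. f i (y i)) \<le> (\<Sum>i=1..N. f i (x i))" if x: "mono_on {1..N} x"
  proof -
    let ?x = "\<lambda>i. max l (min u (x i))"
    have "mono_on {1..N} ?x"
      using x by (intro mono_onI max.mono min.mono order_refl) (rule mono_onD)
    have "(\<Sum>i=1..N. f i (y i)) = h (Suc N) u"
      using backward_pass_value(2)[OF fp bp, of N] bp by (simp add: backward_pass_def)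
    also have "\<dots> \<le> (\<Sum>i=1..N. f i (?x i))"
      by (rule bellman_lower_bound[OF fp _ \<open>mono_on {1..N} ?x\<close>]) (use l_less_u in auto)
    also have "\<dots> \<le> (\<Sum>i=1..N. f i (x i))"
      by (rule sum_mono) (rule f_clamp_le)
    finally show ?thesis .
  qed
qed

lemma dp_returns_iff:
  "dp_returns U B N \<sigma> w a b y \<longleftrightarrow> (\<exists>h L. forward_pass U B N f l u h L \<and> backward_pass N u h L y)"
  by (simp add: dp_returns_def Let_def f_def[abs_def] u_def)

end

theorem theorem2:
  fixes U :: "real \<Rightarrow> real" and B \<sigma> :: real and N :: nat and w a b :: "nat \<Rightarrow> real"
  assumes "s_shaped_utility U B"
    and "N \<ge> 1"
    and "\<sigma> > 0"
    and "mono_on {1..N} w"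
    and "\<And>i. i \<in> {1..N} \<Longrightarrow> a i > 0"
    and "\<And>i. i \<in> {1..N} \<Longrightarrow> b i > 0"
    and "\<And>i. i \<in> {1..N} \<Longrightarrow> continuous_on UNIV (zeta U B (a i) (b i) (w i) \<sigma>)"
  shows "(\<exists>y. dp_returns U B N \<sigma> w a b y) \<and>
         (\<forall>y. dp_returns U B N \<sigma> w a b y \<longrightarrow>
            is_arg_min
              (\<lambda>y. \<Sum>i=1..N. - (if y i \<le> B then a i else b i) * U (y i) + \<sigma> / 2 * (y i - w i)\<^sup>2)
              (\<lambda>y. mono_on {1..N} y) y)"
proof -
  interpret isotonic_utility_problem U B \<sigma> N w a b
    using assms by unfold_locales
  have obj: "(\<Sum>i=1..N. - (if y i \<le> B then a i else b i) * U (y i) + \<sigma> / 2 * (y i - w i)\<^sup>2) =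
      (\<Sum>i=1..N. f i (y i))" for y
    by (simp only: f_def zeta_def)
  show ?thesis
    unfolding obj dp_returns_iff is_arg_min_linorder
    using forward_pass_exists backward_pass_exists backward_pass_optimal by blast
qed

end
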